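(* Let $a_1,a_2,b_1$ be complex numbers with $a_1,a_2\notin\{0,-1,-2,\ldots\}$, and put $s_1=b_1-a_1-a_2$. If $\Re(s_1)>0$, then $$\sum_{l=0}^{m-1}\frac{\Gamma(a_1+l)\Gamma(a_2+l)}{\Gamma(b_1+l)\Gamma(1+l)}=\frac{\Gamma(a_1)\Gamma(a_2)\Gamma(s_1)}{\Gamma(a_1+s_1)\Gamma(a_2+s_1)}+O(m^{-s_1})$$ as $m\to\infty$ through the positive integers.
   Context: The parameters are fixed and $m\to\infty$. For complex $s$, $O(m^{-s})$ means a quantity bounded in absolute value by a constant (depending on the parameters) times $m^{-\Re(s)}$. $1/\Gamma$ is regarded as an entire function, equal to $0$ at the nonpositive integers. *)

theory Defs
  imports "HOL-Analysis.Gamma_Function" "HOL-Library.Landau_Symbols"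
begin

end

theory Submission
  imports Defs "HOL-Real_Asymp.Real_Asymp"
begin

text \<open>
  The limit of the partial sums is Gauss' value of \<open>\<^sub>2F\<^sub>1(a\<^sub>1, a\<^sub>2; b\<^sub>1; 1)\<close>, up to the
  normalisation by Gamma factors, and the error is the tail of an absolutely convergent series.

  Everything rests on one asymptotic fact, \<open>Gamma_quotient_asymp\<close>: a quotient of two shifted
  Gamma values by two others behaves like a power of the shift. Applied to the terms of the series
  it says that they have modulus of order \<open>l powr (- Re s\<^sub>1 - 1)\<close>. Comparing such a tail with
  a telescoping sum of powers gives the error bound (\<open>tail_bigo_powr\<close>).

  For the value (\<open>Gauss_summation\<close>), write \<open>S(c)\<close> for the sum with denominator parameter \<open>c\<close>.
  Gauss' contiguous relation
  \<open>(c - a - b) S(c) = (c - a) (c - b) S(c + 1)\<close> holds because the difference of the two sides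
  telescopes termwise. Iterating it expresses \<open>S(c)\<close> through \<open>S(c + n)\<close>. As \<open>n\<close> grows, only the
  term \<open>l = 0\<close> of \<open>Gamma(c + n) S(c + n)\<close> survives, by dominated convergence
  (\<open>hyp_term_sum_limit\<close>), and the remaining Gamma factors tend to \<open>1\<close>
  by \<open>Gamma_quotient_asymp\<close> because their exponents cancel.

  The parameter \<open>c\<close> may be a pole of Gamma, and so may \<open>c - a\<close> and \<open>c - b\<close>. The argument is
  therefore written with the entire function \<open>rGamma\<close> wherever these occur; the values
  \<open>Gamma(c + n)\<close> matter only in the limit, where \<open>c + n\<close> has left the poles behind.
\<close>

section \<open>Quotients of shifted Gamma values\<close>

text \<open>
  Away from the poles this is Euler's product limit for \<open>rGamma w\<close>, divided by its value. At a
  pole that value is \<open>0\<close> and the division fails; but \<open>rGamma_plus1\<close> carries the asymptotics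
  from \<open>w + 1\<close> down to \<open>w\<close>, so finitely many steps reach every \<open>w\<close> from a regular point.
\<close>
lemma rGamma_shift_asymp:
  fixes w :: complex
  shows "(\<lambda>n. rGamma (w + 1 + of_nat n) * fact n * of_nat n powr w) \<longlonglongrightarrow> 1" (is "?P w")
proof -
  have generic: "?P w" if w: "w \<notin> \<int>\<^sub>\<le>\<^sub>0" for w :: complex
  proof (rule Lim_transform_eventually)
    have "(\<lambda>n. rGamma w / rGamma_series w n) \<longlonglongrightarrow> rGamma w / rGamma w"
      by (intro tendsto_intros) (use w in \<open>simp add: rGamma_eq_zero_iff\<close>)
    then show "(\<lambda>n. rGamma w / rGamma_series w n) \<longlonglongrightarrow> 1"
      using w by (simp add: rGamma_eq_zero_iff)
    show "\<forall>\<^sub>F n in sequentially. rGamma w / rGamma_series w n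
            = rGamma (w + 1 + of_nat n) * fact n * of_nat n powr w"
      using eventually_gt_at_top[of 0]
    proof eventually_elim
      case (elim n)
      have "pochhammer w (n + 1) \<noteq> 0"
        using w by (auto simp: pochhammer_eq_0_iff)
      moreover have "rGamma w = pochhammer w (n + 1) * rGamma (w + 1 + of_nat n)"
        using pochhammer_rGamma[of w "n + 1"] by (simp add: add_ac)
      ultimately show ?case
        using elim by (simp add: rGamma_series_def powr_def Ln_of_nat del: of_nat_Suc)
    qed
  qed
  have descend: "?P w" if "?P (w + 1)" for w :: complex
  proof (rule Lim_transform_eventually)
    have "(\<lambda>n. (w + 1) * inverse (of_nat n) + 1) \<longlonglongrightarrow> (w + 1) * 0 + 1"
      by (intro tendsto_intros lim_inverse_n)
    from tendsto_mult[OF this that]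
    show "(\<lambda>n. ((w + 1) * inverse (of_nat n) + 1)
            * (rGamma (w + 1 + 1 + of_nat n) * fact n * of_nat n powr (w + 1))) \<longlonglongrightarrow> 1"
      by simp
    show "\<forall>\<^sub>F n in sequentially. ((w + 1) * inverse (of_nat n) + 1)
            * (rGamma (w + 1 + 1 + of_nat n) * fact n * of_nat n powr (w + 1))
          = rGamma (w + 1 + of_nat n) * fact n * of_nat n powr w"
      using eventually_gt_at_top[of 0]
    proof eventually_elim
      case (elim n)
      have "rGamma (w + 1 + of_nat n) = (w + 1 + of_nat n) * rGamma (w + 1 + 1 + of_nat n)"
        using rGamma_plus1[of "w + 1 + of_nat n"] by (simp add: add_ac)
      then show ?case
        using elim by (simp add: powr_add field_simps)
    qed
  qed
  have "?P (w + of_nat k) \<Longrightarrow> ?P w" for k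
  proof (induction k)
    case (Suc k)
    have "?P (w + of_nat k + 1)"
      using Suc.prems by (simp add: add_ac)
    then show ?case
      by (rule Suc.IH[OF descend])
  qed simp
  moreover have "\<exists>k. w + of_nat k \<notin> \<int>\<^sub>\<le>\<^sub>0"
  proof (cases "w \<in> \<int>\<^sub>\<le>\<^sub>0")
    case True
    then obtain j where "w = - of_nat j"
      by (auto elim!: nonpos_Ints_cases')
    then have "w + of_nat (Suc j) = 1"
      by simp
    then show ?thesis
      by (metis one_notin_nonpos_Ints)
  qed (auto intro: exI[of _ 0])
  ultimately show ?thesis
    using generic by blast
qed

text \<open>
  Two Gamma values against two leave no factorials behind, only a power of \<open>n\<close>. Poles of
  Gamma are met for finitely many \<open>n\<close> only, so they do not affect the limit.
\<close>
lemma Gamma_quotient_asymp: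
  fixes u1 u2 v1 v2 :: complex
  shows "(\<lambda>n. Gamma (u1 + of_nat n) * Gamma (u2 + of_nat n)
              * (rGamma (v1 + of_nat n) * rGamma (v2 + of_nat n))
              * of_nat n powr (v1 + v2 - u1 - u2)) \<longlonglongrightarrow> 1"
proof -
  define R where "R = (\<lambda>z n. rGamma (z + of_nat n) * fact n * of_nat n powr (z - 1 :: complex))"
  have R: "R z \<longlonglongrightarrow> 1" for z
    using rGamma_shift_asymp[of "z - 1"] by (simp add: R_def)
  show ?thesis
  proof (rule Lim_transform_eventually)
    have "(\<lambda>n. R v1 n * R v2 n / (R u1 n * R u2 n)) \<longlonglongrightarrow> 1 * 1 / (1 * 1)"
      by (intro tendsto_intros R) auto
    then show "(\<lambda>n. R v1 n * R v2 n / (R u1 n * R u2 n)) \<longlonglongrightarrow> 1"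
      by simp
    show "\<forall>\<^sub>F n in sequentially. R v1 n * R v2 n / (R u1 n * R u2 n) =
      Gamma (u1 + of_nat n) * Gamma (u2 + of_nat n)
              * (rGamma (v1 + of_nat n) * rGamma (v2 + of_nat n))
              * of_nat n powr (v1 + v2 - u1 - u2)"
      using eventually_gt_at_top[of 0]
    proof eventually_elim
      case (elim n)
      have "of_nat n powr (v1 + v2 - u1 - u2) =
         of_nat n powr (v1 - 1) * of_nat n powr (v2 - 1)
           / (of_nat n powr (u1 - 1) * of_nat n powr (u2 - 1) :: complex)"
        unfolding powr_add[symmetric] powr_diff[symmetric]
        by (rule arg_cong[where f = "\<lambda>e. of_nat n powr e"]) simp
      then show ?case
        by (simp add: R_def Gamma_def divide_inverse) (simp add: field_simps)
    qed
  qed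
qed

section \<open>The terms of the series\<close>

text \<open>
  For regular \<open>c\<close> this is \<open>Gamma(a) Gamma(b) / Gamma(c)\<close> times the \<open>l\<close>-th term of
  \<open>\<^sub>2F\<^sub>1(a, b; c; 1)\<close>. In this normalisation it is entire in \<open>c\<close>.
\<close>
definition hyp_term :: "complex \<Rightarrow> complex \<Rightarrow> complex \<Rightarrow> nat \<Rightarrow> complex" where
  "hyp_term a b c l = Gamma (a + of_nat l) * Gamma (b + of_nat l)
                        * (rGamma (c + of_nat l) * rGamma (1 + of_nat l))"

lemma norm_of_nat_powr: "n > 0 \<Longrightarrow> norm (of_nat n powr z :: complex) = real n powr Re z"
  using norm_powr_real_powr[of "of_nat n" z] by simp

text \<open>
  The factor \<open>rGamma (1 + l)\<close> plays the role of a second denominator parameter \<open>1\<close> in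
  \<open>Gamma_quotient_asymp\<close>; it shifts the exponent from \<open>c - a - b\<close> to \<open>c - a - b + 1\<close>.
\<close>
lemma hyp_term_bigo:
  "(\<lambda>l. norm (hyp_term a b c l)) \<in> O(\<lambda>l. real l powr (- Re (c - a - b) - 1))"
proof -
  have "(\<lambda>l. hyp_term a b c l * of_nat l powr (c + 1 - a - b)) \<longlonglongrightarrow> 1"
    unfolding hyp_term_def by (rule Gamma_quotient_asymp)
  then have "Bseq (\<lambda>l. hyp_term a b c l * of_nat l powr (c + 1 - a - b))"
    by (rule convergent_imp_Bseq[OF convergentI])
  then obtain K where K: "norm (hyp_term a b c l * of_nat l powr (c + 1 - a - b)) \<le> K" for l
    by (auto elim!: BseqE)
  show ?thesis
  proof (rule bigoI)
    show "\<forall>\<^sub>F l in sequentially. norm (norm (hyp_term a b c l))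
            \<le> K * norm (real l powr (- Re (c - a - b) - 1))"
      using eventually_gt_at_top[of 0]
    proof eventually_elim
      case (elim l)
      define e where "e = Re (c + 1 - a - b)"
      have "norm (hyp_term a b c l) * real l powr e \<le> K"
        using K[of l] elim by (simp add: norm_mult norm_of_nat_powr e_def)
      then have "norm (hyp_term a b c l) \<le> K * real l powr (- e)"
        using elim by (simp add: powr_minus field_simps)
      moreover have "- e = - Re (c - a - b) - 1"
        by (simp add: e_def)
      ultimately show ?case
        by (metis abs_of_nonneg norm_ge_zero powr_ge_zero real_norm_def)
    qed
  qed
qed

lemma summable_norm_hyp_term:
  assumes "Re (c - a - b) > 0"
  shows "summable (\<lambda>l. norm (hyp_term a b c l))"
proof (rule summable_comparison_test_bigo[OF _ hyp_term_bigo])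
  show "summable (\<lambda>l. norm (real l powr (- Re (c - a - b) - 1)))"
    using assms by (simp add: summable_real_powr_iff)
qed

section \<open>The contiguous relation in the denominator parameter\<close>

lemma hyp_term_denominator_shift:
  "hyp_term a b c l = (c + of_nat l) * hyp_term a b (c + 1) l"
  using rGamma_plus1[of "c + of_nat l"] by (simp add: hyp_term_def add_ac)

lemma hyp_term_Suc:
  assumes "a \<notin> \<int>\<^sub>\<le>\<^sub>0" "b \<notin> \<int>\<^sub>\<le>\<^sub>0"
  shows "of_nat (Suc l) * hyp_term a b c (Suc l)
           = (a + of_nat l) * (b + of_nat l) * hyp_term a b (c + 1) l"
proof -
  have shift: "Gamma (z + of_nat (Suc l)) = (z + of_nat l) * Gamma (z + of_nat l)"
    if "z \<notin> \<int>\<^sub>\<le>\<^sub>0" for z :: complex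
  proof -
    have "z + of_nat l \<notin> \<int>\<^sub>\<le>\<^sub>0"
      using nonpos_Ints_diff_Nats[of "z + of_nat l" "of_nat l"] that by auto
    from Gamma_plus1[OF this] show ?thesis
      by (simp add: add_ac)
  qed
  have "rGamma (1 + of_nat l :: complex) = of_nat (Suc l) * rGamma (1 + of_nat (Suc l))"
    using rGamma_plus1[of "1 + of_nat l :: complex"] by (simp add: add_ac)
  then show ?thesis
    unfolding hyp_term_def shift[OF assms(1)] shift[OF assms(2)]
    by (simp add: add_ac)
qed

text \<open>
  With \<open>T\<close> and \<open>U\<close> the terms for \<open>c\<close> and \<open>c + 1\<close>, both \<open>l T(l) = l (c + l) U(l)\<close> and
  \<open>(l + 1) T(l + 1) = (a + l) (b + l) U(l)\<close> are polynomial multiples of \<open>U(l)\<close>. Their difference is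
  \<open>(c - a) (c - b) U(l) - (c - a - b) T(l)\<close>, and \<open>l T(l)\<close> vanishes at both ends of the summation:
  at infinity exactly because \<open>Re (c - a - b) > 0\<close>.
\<close>
lemma hyp_term_contiguous:
  assumes "a \<notin> \<int>\<^sub>\<le>\<^sub>0" "b \<notin> \<int>\<^sub>\<le>\<^sub>0" and s: "Re (c - a - b) > 0"
  shows "(c - a - b) * (\<Sum>l. hyp_term a b c l)
           = (c - a) * (c - b) * (\<Sum>l. hyp_term a b (c + 1) l)"
proof -
  define G where "G = (\<lambda>l. of_nat l * hyp_term a b c l)"
  have "(\<lambda>l. real l * norm (hyp_term a b c l))
          \<in> O(\<lambda>l. real l * real l powr (- Re (c - a - b) - 1))"
    by (intro landau_o.big.mult hyp_term_bigo) simp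
  moreover have "(\<lambda>l. real l * real l powr (- Re (c - a - b) - 1)) \<longlonglongrightarrow> 0"
    using s by real_asymp
  then have "(\<lambda>l. real l * real l powr (- Re (c - a - b) - 1)) \<in> o(\<lambda>_. 1)"
    by (intro smalloI_tendsto) auto
  ultimately have "(\<lambda>l. real l * norm (hyp_term a b c l)) \<in> o(\<lambda>_. 1)"
    by (rule landau_o.big_small_trans)
  from smalloD_tendsto[OF this] have "(\<lambda>l. real l * norm (hyp_term a b c l)) \<longlonglongrightarrow> 0"
    by simp
  then have "G \<longlonglongrightarrow> 0"
    by (intro tendsto_norm_zero_cancel[of G]) (simp add: G_def norm_mult)
  then have "(\<lambda>l. G (Suc l) - G l) sums (0 - G 0)"
    by (rule telescope_sums)
  moreover have "G (Suc l) - G l =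
      (c - a) * (c - b) * hyp_term a b (c + 1) l - (c - a - b) * hyp_term a b c l" for l
    unfolding G_def hyp_term_Suc[OF assms(1,2)] hyp_term_denominator_shift[of a b c l]
    by (simp add: algebra_simps)
  ultimately have "(\<lambda>l. (c - a) * (c - b) * hyp_term a b (c + 1) l
                          - (c - a - b) * hyp_term a b c l) sums 0"
    by (simp add: G_def)
  moreover have "summable (hyp_term a b c)" "summable (hyp_term a b (c + 1))"
    using s by (auto intro!: summable_norm_cancel[OF summable_norm_hyp_term])
  then have "(\<lambda>l. (c - a) * (c - b) * hyp_term a b (c + 1) l
                    - (c - a - b) * hyp_term a b c l)
      sums ((c - a) * (c - b) * (\<Sum>l. hyp_term a b (c + 1) l)
              - (c - a - b) * (\<Sum>l. hyp_term a b c l))"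
    by (intro sums_diff sums_mult summable_sums)
  ultimately show ?thesis
    using sums_unique2 by fastforce
qed

lemma hyp_term_contiguous_iterated:
  assumes "a \<notin> \<int>\<^sub>\<le>\<^sub>0" "b \<notin> \<int>\<^sub>\<le>\<^sub>0" and s: "Re (c - a - b) > 0"
  shows "pochhammer (c - a - b) n * (\<Sum>l. hyp_term a b c l)
           = pochhammer (c - a) n * pochhammer (c - b) n * (\<Sum>l. hyp_term a b (c + of_nat n) l)"
proof (induction n)
  case (Suc n)
  have "pochhammer (c - a - b) (Suc n) * (\<Sum>l. hyp_term a b c l)
      = (c + of_nat n - a - b) * (pochhammer (c - a - b) n * (\<Sum>l. hyp_term a b c l))"
    by (simp add: pochhammer_Suc algebra_simps)
  also have "\<dots> = pochhammer (c - a) n * pochhammer (c - b) n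
      * ((c + of_nat n - a - b) * (\<Sum>l. hyp_term a b (c + of_nat n) l))"
    unfolding Suc.IH by (simp only: mult_ac)
  also have "(c + of_nat n - a - b) * (\<Sum>l. hyp_term a b (c + of_nat n) l)
      = (c + of_nat n - a) * (c + of_nat n - b) * (\<Sum>l. hyp_term a b (c + of_nat n + 1) l)"
    using s by (intro hyp_term_contiguous assms) simp
  also have "pochhammer (c - a) n * pochhammer (c - b) n * \<dots>
      = pochhammer (c - a) (Suc n) * pochhammer (c - b) (Suc n)
          * (\<Sum>l. hyp_term a b (c + of_nat (Suc n)) l)"
    by (simp add: pochhammer_Suc add_ac add_diff_eq)
  finally show ?case .
qed simp

section \<open>Gauss' summation formula\<close>

text \<open>
  This provides a majorant that is uniform in \<open>z\<close> on a right half-plane.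
\<close>
lemma pochhammer_le_norm_pochhammer:
  assumes "x > 0" "x \<le> Re z"
  shows "pochhammer x l \<le> norm (pochhammer z l)"
proof -
  have "x + real i \<le> norm (z + of_nat i)" for i
    using assms complex_Re_le_cmod[of "z + of_nat i"] by simp
  then show ?thesis
    unfolding pochhammer_prod prod_norm [symmetric]
    using assms by (intro prod_mono) auto
qed

lemma Gamma_times_rGamma_shift:
  assumes "z \<notin> \<int>\<^sub>\<le>\<^sub>0"
  shows "Gamma z * rGamma (z + of_nat l) = inverse (pochhammer z l)"
proof -
  have "rGamma z \<noteq> 0"
    using assms by (simp add: rGamma_eq_zero_iff)
  then show ?thesis
    unfolding Gamma_def pochhammer_rGamma[of z l] by (simp add: field_simps)
qed

text \<open>
  In \<open>Gamma(c + n)\<close> times the series the denominator becomes \<open>pochhammer (c + n) l\<close>, which is \<open>1\<close>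
  for \<open>l = 0\<close> and grows like \<open>n ^ l\<close> otherwise. Once \<open>n\<close> exceeds a suitable \<open>N\<close>, the terms are
  dominated by those for the positive real parameter \<open>Re c + N\<close>, which form a summable sequence,
  so Tannery's theorem applies.
\<close>
lemma hyp_term_sum_limit:
  "(\<lambda>n. Gamma (c + of_nat n) * (\<Sum>l. hyp_term a b (c + of_nat n) l)) \<longlonglongrightarrow> Gamma a * Gamma b"
proof -
  \<comment> \<open>This makes \<open>Re c + N\<close> positive and a denominator parameter with a convergent series.\<close>
  obtain N :: nat where N: "real N > max (- Re c) (- Re (c - a - b))"
    using reals_Archimedean2 by blast
  define x where "x = Re c + real N"
  have x: "x > 0" "Re (of_real x - a - b) > 0"
    using N by (auto simp: x_def)
  define f where "f = (\<lambda>l n. Gamma (c + of_nat n) * hyp_term a b (c + of_nat n) l)"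
  define M where "M = (\<lambda>l. norm (Gamma (of_real x) * hyp_term a b (of_real x) l))"
  define g where "g = (\<lambda>l::nat. if l = 0 then Gamma a * Gamma b else 0)"
  have nonpos: "z \<notin> \<int>\<^sub>\<le>\<^sub>0" if "Re z > 0" for z :: complex
    using that by (auto elim!: nonpos_Ints_cases)
  have factor: "Gamma z * hyp_term a b z l = Gamma (a + of_nat l) * Gamma (b + of_nat l)
      * rGamma (1 + of_nat l) * inverse (pochhammer z l)" if "Re z > 0" for z l
    using Gamma_times_rGamma_shift[OF nonpos[OF that], of l]
    by (simp add: hyp_term_def mult_ac)
  have "\<forall>\<^sub>F n in sequentially. f 0 n = Gamma a * Gamma b"
    using eventually_ge_at_top[of N]
  proof eventually_elim
    case (elim n)
    then have "Re (c + of_nat n) > 0" using x by (simp add: x_def)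
    then show ?case by (simp add: f_def factor)
  qed
  then have lim0: "f 0 \<longlonglongrightarrow> Gamma a * Gamma b"
    by (rule tendsto_eventually)
  have lim: "f l \<longlonglongrightarrow> g l" for l
  proof (cases "l = 0")
    case False
    \<comment> \<open>The spare pair of parameters \<open>1\<close> only brings the quotient into the two-by-two form.\<close>
    have quot: "(\<lambda>n. Gamma (c + of_nat n) * Gamma (1 + of_nat n)
        * (rGamma (c + of_nat l + of_nat n) * rGamma (1 + of_nat n))
        * of_nat n powr (c + of_nat l + 1 - c - 1)) \<longlonglongrightarrow> 1"
      by (rule Gamma_quotient_asymp)
    have "(\<lambda>n. inverse (of_nat n) ^ l :: complex) \<longlonglongrightarrow> 0 ^ l"
      by (intro tendsto_power lim_inverse_n)
    from tendsto_mult[OF quot this]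
    have "(\<lambda>n. Gamma (c + of_nat n) * Gamma (1 + of_nat n)
        * (rGamma (c + of_nat l + of_nat n) * rGamma (1 + of_nat n))
        * of_nat n powr (c + of_nat l + 1 - c - 1) * inverse (of_nat n) ^ l) \<longlonglongrightarrow> 0"
      using False by (simp add: power_0_left)
    moreover have "\<forall>\<^sub>F n in sequentially. Gamma (c + of_nat n) * Gamma (1 + of_nat n)
        * (rGamma (c + of_nat l + of_nat n) * rGamma (1 + of_nat n))
        * of_nat n powr (c + of_nat l + 1 - c - 1) * inverse (of_nat n) ^ l
        = Gamma (c + of_nat n) * rGamma (c + of_nat n + of_nat l)"
      using eventually_gt_at_top[of 0]
    proof eventually_elim
      case (elim n)
      have "Gamma (1 + of_nat n) * rGamma (1 + of_nat n :: complex) = 1"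
        using nonpos[of "1 + of_nat n"] by (simp add: Gamma_def rGamma_eq_zero_iff)
      moreover have "of_nat n powr (c + of_nat l + 1 - c - 1) * inverse (of_nat n) ^ l = (1::complex)"
        using elim by (simp add: powr_nat' power_inverse)
      ultimately show ?case
        by (simp add: add_ac mult_ac)
    qed
    ultimately have "(\<lambda>n. Gamma (c + of_nat n) * rGamma (c + of_nat n + of_nat l)) \<longlonglongrightarrow> 0"
      by (rule Lim_transform_eventually)
    then have "(\<lambda>n. Gamma (a + of_nat l) * Gamma (b + of_nat l) * rGamma (1 + of_nat l)
        * (Gamma (c + of_nat n) * rGamma (c + of_nat n + of_nat l))) \<longlonglongrightarrow> 0"
      by (rule tendsto_mult_right_zero)
    then show ?thesis
      using False by (simp add: f_def g_def hyp_term_def mult_ac)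
  qed (use lim0 in \<open>simp add: g_def\<close>)
  have bound: "norm (f l n) \<le> M l" if "n \<ge> N" for l n
  proof -
    have Re: "x \<le> Re (c + of_nat n)" using that by (simp add: x_def)
    then have "pochhammer x l \<le> norm (pochhammer (c + of_nat n) l)"
      by (intro pochhammer_le_norm_pochhammer x)
    moreover have pos: "pochhammer x l > 0" using x by (simp add: pochhammer_pos)
    moreover have "norm (pochhammer (of_real x :: complex) l) = pochhammer x l"
      using pos by (simp add: pochhammer_of_real)
    ultimately have "inverse (norm (pochhammer (c + of_nat n) l))
        \<le> inverse (norm (pochhammer (of_real x :: complex) l))"
      by (simp add: le_imp_inverse_le)
    moreover have "Re (c + of_nat n) > 0" "Re (of_real x) > 0" using Re x by auto
    ultimately show ?thesis
      unfolding f_def M_def by (subst (1 2) factor) (auto simp: norm_mult norm_inverse intro!: mult_left_mono)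
  qed
  have "(\<lambda>n. suminf (\<lambda>l. f l n)) \<longlonglongrightarrow> suminf g"
  proof (intro tannerys_theorem[THEN conjunct2, THEN conjunct2])
    show "summable M"
      unfolding M_def norm_mult by (intro summable_mult summable_norm_hyp_term x)
    show "\<forall>\<^sub>F (l, n) in sequentially \<times>\<^sub>F sequentially. norm (f l n) \<le> M l"
      unfolding eventually_prod_sequentially using bound by auto
  qed (use lim in auto)
  moreover have "suminf g = Gamma a * Gamma b"
    using suminf_finite[of "{0}" g] by (simp add: g_def)
  moreover have "\<forall>\<^sub>F n in sequentially. suminf (\<lambda>l. f l n)
      = Gamma (c + of_nat n) * (\<Sum>l. hyp_term a b (c + of_nat n) l)"
    using eventually_ge_at_top[of N]
  proof eventually_elim
    case (elim n)
    have "Re (c + of_nat n - a - b) > 0" using elim N by simp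
    then show ?case
      unfolding f_def
      by (intro suminf_mult summable_norm_cancel[OF summable_norm_hyp_term])
  qed
  ultimately show ?thesis
    using Lim_transform_eventually by fastforce
qed

text \<open>
  Multiplying the iterated contiguous relation by \<open>rGamma\<close> values turns its Pochhammer symbols into
  \<open>rGamma (c - a)\<close>, \<open>rGamma (c - b)\<close> and \<open>rGamma s\<close>, independent of \<open>n\<close>. What depends on \<open>n\<close> is the
  quotient \<open>Q\<close>, whose limit is \<open>1\<close> since \<open>(c - a) + (c - b) = c + s\<close>, and the normalised sum
  of \<open>hyp_term_sum_limit\<close>. No division by \<open>rGamma (c - a)\<close> or \<open>rGamma (c - b)\<close> occurs, so the case
  where one of them vanishes is covered.
\<close>
lemma Gauss_summation:
  assumes "a \<notin> \<int>\<^sub>\<le>\<^sub>0" "b \<notin> \<int>\<^sub>\<le>\<^sub>0" and s: "Re (c - a - b) > 0"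
  shows "(\<Sum>l. hyp_term a b c l)
           = Gamma a * Gamma b * Gamma (c - a - b) * (rGamma (c - a) * rGamma (c - b))"
proof -
  define S where "S = (\<lambda>n. \<Sum>l. hyp_term a b (c + of_nat n) l)"
  define s where "s = c - a - b"
  define Q where "Q = (\<lambda>n. Gamma (c + of_nat n) * Gamma (s + of_nat n)
      * (rGamma (c - a + of_nat n) * rGamma (c - b + of_nat n)))"
  have s_nonpos: "s + of_nat n \<notin> \<int>\<^sub>\<le>\<^sub>0" for n
    using s by (auto simp: s_def elim!: nonpos_Ints_cases dest!: arg_cong[where f = Re])
  have "(\<lambda>n. Q n * of_nat n powr (c - a + (c - b) - c - s)) \<longlonglongrightarrow> 1"
    unfolding Q_def by (rule Gamma_quotient_asymp)
  then have Q: "Q \<longlonglongrightarrow> 1"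
    by (rule Lim_transform_eventually)
       (use eventually_gt_at_top[of 0] in eventually_elim, simp add: s_def)
  have S_lim: "(\<lambda>n. Gamma (c + of_nat n) * S n) \<longlonglongrightarrow> Gamma a * Gamma b"
    unfolding S_def by (rule hyp_term_sum_limit)
  have key: "rGamma s * S 0 * Q n = rGamma (c - a) * rGamma (c - b) * (Gamma (c + of_nat n) * S n)" for n
  proof -
    have "pochhammer s n * S 0 = pochhammer (c - a) n * pochhammer (c - b) n * S n"
      using hyp_term_contiguous_iterated[OF assms, of n] by (simp add: S_def s_def)
    moreover have "pochhammer s n = rGamma s * Gamma (s + of_nat n)"
      using s_nonpos[of n] pochhammer_rGamma[of s n] by (simp add: Gamma_def rGamma_eq_zero_iff)
    ultimately have "rGamma s * Gamma (s + of_nat n) * S 0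
        = pochhammer (c - a) n * pochhammer (c - b) n * S n"
      by (simp only:)
    then have "(rGamma s * Gamma (s + of_nat n) * S 0)
          * (Gamma (c + of_nat n) * rGamma (c - a + of_nat n) * rGamma (c - b + of_nat n))
        = (pochhammer (c - a) n * pochhammer (c - b) n * S n)
          * (Gamma (c + of_nat n) * rGamma (c - a + of_nat n) * rGamma (c - b + of_nat n))"
      by (simp only:)
    then show ?thesis
      unfolding Q_def pochhammer_rGamma[of "c - a" n] pochhammer_rGamma[of "c - b" n]
      by (simp only: mult_ac)
  qed
  have "(\<lambda>n. rGamma s * S 0 * Q n) \<longlonglongrightarrow> rGamma s * S 0 * 1"
    by (intro tendsto_intros Q)
  moreover have "(\<lambda>n. rGamma s * S 0 * Q n) \<longlonglongrightarrow> rGamma (c - a) * rGamma (c - b) * (Gamma a * Gamma b)"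
    unfolding key by (intro tendsto_mult_left S_lim)
  ultimately have "rGamma s * S 0 = rGamma (c - a) * rGamma (c - b) * (Gamma a * Gamma b)"
    using LIMSEQ_unique by fastforce
  moreover have "rGamma s \<noteq> 0"
    using s_nonpos[of 0] by (simp add: rGamma_eq_zero_iff)
  ultimately have "S 0 = Gamma a * Gamma b * Gamma s * (rGamma (c - a) * rGamma (c - b))"
    by (simp add: Gamma_def[of s] field_simps)
  then show ?thesis
    by (simp add: S_def s_def)
qed

section \<open>Tails of power-like series\<close>

lemma powr_le_powr_difference:
  fixes t \<sigma> :: real
  assumes "t > 0" "\<sigma> > 0"
  shows "\<sigma> * (t + 1) powr (- \<sigma> - 1) \<le> t powr (- \<sigma>) - (t + 1) powr (- \<sigma>)"
proof -
  have "\<exists>z. t < z \<and> z < t + 1 \<and>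
      (t + 1) powr (- \<sigma>) - t powr (- \<sigma>) = (t + 1 - t) * (- \<sigma> * z powr (- \<sigma> - 1))"
    using assms by (intro MVT2) (auto intro!: derivative_eq_intros)
  then obtain z where z: "t < z" "z < t + 1"
      "(t + 1) powr (- \<sigma>) - t powr (- \<sigma>) = - \<sigma> * z powr (- \<sigma> - 1)"
    by auto
  have "(t + 1) powr (- \<sigma> - 1) \<le> z powr (- \<sigma> - 1)"
    using z assms by (intro powr_mono2') auto
  then have "\<sigma> * (t + 1) powr (- \<sigma> - 1) \<le> \<sigma> * z powr (- \<sigma> - 1)"
    using assms by (intro mult_left_mono) auto
  then show ?thesis
    using z(3) by simp
qed

text \<open>
  By \<open>powr_le_powr_difference\<close> the terms are dominated by differences of \<open>(l - 1) powr (- \<sigma>)\<close>, so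
  the tail from \<open>m\<close> on is dominated by the first of these powers, \<open>(m - 1) powr (- \<sigma>)\<close>.
\<close>
lemma tail_bigo_powr:
  fixes f :: "nat \<Rightarrow> 'a :: banach"
  assumes \<sigma>: "\<sigma> > 0" and f: "(\<lambda>l. norm (f l)) \<in> O(\<lambda>l. real l powr (- \<sigma> - 1))"
  shows "(\<lambda>m. norm ((\<Sum>l<m. f l) - suminf f)) \<in> O(\<lambda>m. real m powr (- \<sigma>))"
proof -
  from f obtain C where C: "C > 0"
      "\<forall>\<^sub>F l in sequentially. norm (norm (f l)) \<le> C * norm (real l powr (- \<sigma> - 1))"
    by (elim landau_o.bigE)
  then obtain N where N: "\<And>l. l \<ge> N \<Longrightarrow> norm (f l) \<le> C * real l powr (- \<sigma> - 1)"
    by (auto simp: eventually_at_top_linorder)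
  have summable: "summable (\<lambda>l. norm (f l))"
    by (rule summable_comparison_test_bigo[OF _ f]) (use \<sigma> in \<open>simp add: summable_real_powr_iff\<close>)
  \<comment> \<open>The bound \<open>2\<close> keeps the base \<open>m - 1\<close> of the comparison powers positive.\<close>
  have "norm ((\<Sum>l<m. f l) - suminf f) \<le> C / \<sigma> * (real m - 1) powr (- \<sigma>)"
    if m: "m \<ge> max N 2" for m
  proof -
    define h where "h = (\<lambda>l. C / \<sigma> * (real (l + m) - 1) powr (- \<sigma>))"
    have "h \<longlonglongrightarrow> 0"
      unfolding h_def using \<sigma> by real_asymp
    then have h: "(\<lambda>l. h l - h (Suc l)) sums (h 0 - 0)"
      by (rule telescope_sums')
    have le: "norm (f (l + m)) \<le> h l - h (Suc l)" for l
    proof -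
      have "norm (f (l + m)) \<le> C / \<sigma> * (\<sigma> * (real (l + m) - 1 + 1) powr (- \<sigma> - 1))"
        using N[of "l + m"] m \<sigma> by simp
      also have "\<dots> \<le> C / \<sigma> * ((real (l + m) - 1) powr (- \<sigma>) - (real (l + m) - 1 + 1) powr (- \<sigma>))"
        using m C \<sigma> by (intro mult_left_mono powr_le_powr_difference) auto
      also have "\<dots> = h l - h (Suc l)"
        by (simp add: h_def algebra_simps)
      finally show ?thesis .
    qed
    have sm: "summable (\<lambda>l. norm (f (l + m)))"
      using summable by (subst summable_iff_shift)
    have "norm ((\<Sum>l<m. f l) - suminf f) = norm (\<Sum>l. f (l + m))"
      using suminf_split_initial_segment[OF summable_norm_cancel[OF summable], of m]
      by (simp add: norm_minus_commute)
    also have "\<dots> \<le> (\<Sum>l. norm (f (l + m)))"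
      by (rule summable_norm[OF sm])
    also have "\<dots> \<le> h 0"
      using sums_le[OF le summable_sums[OF sm] h] by simp
    finally show ?thesis by (simp add: h_def)
  qed
  then have "\<forall>\<^sub>F m in sequentially. norm (norm ((\<Sum>l<m. f l) - suminf f))
      \<le> C / \<sigma> * norm ((real m - 1) powr (- \<sigma>))"
    unfolding eventually_at_top_linorder by (intro exI[of _ "max N 2"]) simp
  then have "(\<lambda>m. norm ((\<Sum>l<m. f l) - suminf f)) \<in> O(\<lambda>m. (real m - 1) powr (- \<sigma>))"
    by (rule bigoI)
  also have "(\<lambda>m. (real m - 1) powr (- \<sigma>)) \<in> O(\<lambda>m. real m powr (- \<sigma>))"
    by real_asymp
  finally show ?thesis .
qed

section \<open>Partial sums of the Gauss series\<close>

theorem theorem1: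
  fixes a1 a2 b1 s1 :: complex
  assumes "a1 \<notin> \<int>\<^sub>\<le>\<^sub>0" and "a2 \<notin> \<int>\<^sub>\<le>\<^sub>0"
    and "s1 = b1 - a1 - a2"
    and "Re s1 > 0"
  shows "(\<lambda>m::nat.
            (\<Sum>l=0..<m. Gamma (a1 + of_nat l) * Gamma (a2 + of_nat l)
                          * (rGamma (b1 + of_nat l) * rGamma (1 + of_nat l)))
            - Gamma a1 * Gamma a2 * Gamma s1 * (rGamma (a1 + s1) * rGamma (a2 + s1)))
         \<in> O(\<lambda>m. complex_of_real (real m powr (- Re s1)))"
proof -
  have "(\<Sum>l. hyp_term a1 a2 b1 l)
          = Gamma a1 * Gamma a2 * Gamma s1 * (rGamma (a1 + s1) * rGamma (a2 + s1))"
    using Gauss_summation[of a1 a2 b1] assms by (simp add: mult_ac)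
  moreover have "(\<lambda>m. norm ((\<Sum>l<m. hyp_term a1 a2 b1 l) - (\<Sum>l. hyp_term a1 a2 b1 l)))
                   \<in> O(\<lambda>m. real m powr (- Re s1))"
    using assms(3,4) hyp_term_bigo[of a1 a2 b1] by (intro tail_bigo_powr) simp_all
  ultimately have "(\<lambda>m. norm ((\<Sum>l=0..<m. hyp_term a1 a2 b1 l)
      - Gamma a1 * Gamma a2 * Gamma s1 * (rGamma (a1 + s1) * rGamma (a2 + s1))))
      \<in> O(\<lambda>m. norm (complex_of_real (real m powr (- Re s1))))"
    by (simp add: lessThan_atLeast0)
  then show ?thesis
    unfolding hyp_term_def by (rule landau_o.big.norm_iff[THEN iffD1])
qed

end
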